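(* Let $\mathfrak X$ be the stack of a weighted hypersurface $X\subset\mathbb P^n_{\mathbf w}$ over $\mathbb F_q$, and let $r\ge1$ be such that $X(\mathbb F_{q^r})\ne\varnothing$. Then $$\mathrm{Ent}^{\mathrm{can}}_{q^r}(\mathfrak X)=\log|X(\mathbb F_{q^r})|+\frac1{|X(\mathbb F_{q^r})|}\sum_{\mathbf x\in X(\mathbb F_{q^r})}\log g_{\mathbf x}(r),$$ the mean of the probabilistic height. If $d=\gcd(w_0,\dots,w_n)$, $\mathbf w'=\mathbf w/d$ and $\mathfrak X'\subset\mathcal P_{\mathbf w'}$ is the stack of the same hypersurface, then $$0\le\mathrm{Ent}^{\mathrm{can}}_{q^r}(\mathfrak X)-\mathrm{Ent}^{\mathrm{can}}_{q^r}(\mathfrak X')\le\log\gcd(d,q^r-1),$$ with equality on the right when $\gcd(d,k_S/d)=1$ for every support $S$ occurring on $X(\mathbb F_{q^r})$.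
   Context: $q$ is a prime power; $\mathbf w=(w_0,\dots,w_n)$ positive integers; $\mathcal P_{\mathbf w}=[(\mathbb A^{n+1}\setminus\{0\})/\mathbb G_m]$ for the action $\lambda\cdot(x_i)=(\lambda^{w_i}x_i)$, with coarse space $\mathbb P^n_{\mathbf w}$. $X=V(f)$ with $f$ weighted homogeneous over $\mathbb F_q$, affine cone $\hat X=\{f=0\}\subset\mathbb A^{n+1}$, stack $\mathfrak X=[(\hat X\setminus\{0\})/\mathbb G_m]$. $X(\mathbb F_{q^r})$ are the points of the coarse variety. $S(\mathbf x)=\{i:x_i\ne0\}$, $k_S=\gcd(w_i:i\in S)$, $g_{\mathbf x}(r)=\gcd(k_{S(\mathbf x)},q^r-1)$. $\pi_0(\mathfrak X(\mathbb F_{q^r}))$ is the set of isomorphism classes ("twists") of $\mathfrak X(\mathbb F_{q^r})$, i.e. of $\mathbb F_{q^r}^\times$-orbits on $\hat X(\mathbb F_{q^r})\setminus\{0\}$; over $\mathbf x$ there are $g_{\mathbf x}(r)$ of them, each with $|\mathrm{Aut}(\xi)(\mathbb F_{q^r})|=g_{\mathbf x}(r)$. The mass of $\xi$ is $1/|\mathrm{Aut}(\xi)(\mathbb F_{q^r})|$, $p_r$ is the mass measure normalized to total mass 1, and the groupoid entropy is $\mathrm{Ent}^{\mathrm{can}}_{q^r}(\mathfrak X)=-\sum_\xi p_r(\xi)\log p_r(\xi)$. The probabilistic height is $H^{\mathrm{prob}}_{\mathbf w,q}(\mathbf x)=-\log\bigl(|\mathbb F_{q^r}^\times\cdot\tilde{\mathbf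 x}|/|\hat X(\mathbb F_{q^r})\setminus\{0\}|\bigr)$ for a representative $\tilde{\mathbf x}\in\hat X(\mathbb F_{q^r})\setminus\{0\}$; its mean is taken with respect to $p_r$ (equivalently, the uniform measure on $X(\mathbb F_{q^r})$). *)

theory Defs
  imports
    Complex_Main
    "HOL-Library.Poly_Mapping"
    "HOL-Library.Cardinality"
    "HOL-Algebra.Group_Action"
    "HOL-Algebra.Algebraic_Closure_Type"
begin

text \<open>
  The ground field \<open>\<F>\<^sub>q\<close> is an arbitrary finite field type \<open>'k\<close>, so \<open>q = CARD('k)\<close>. Coordinates
  are indexed by a finite (hence nonempty) type \<open>'n\<close> with \<open>n + 1\<close> elements. All points live
  over the algebraic closure \<open>'k alg_closure\<close>, and \<open>\<F>\<^bsub>q^r\<^esub>\<close> below is its subfield with \<open>q ^ r\<close>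
  elements, the fixed field of the \<open>q ^ r\<close>-power Frobenius.
\<close>

definition Fqr :: "nat \<Rightarrow> 'k::{field,finite} alg_closure set" where
  "Fqr r = {a. a ^ (CARD('k) ^ r) = a}"

text \<open>
  Polynomials in variables indexed by \<open>'n\<close>: finitely supported functions from exponent
  vectors to coefficients.
\<close>

type_synonym ('n, 'k) mpoly = "('n \<Rightarrow>\<^sub>0 nat) \<Rightarrow>\<^sub>0 'k"

definition mpoly_eval ::
  "('n::finite, 'k::field) mpoly \<Rightarrow> ('n \<Rightarrow> 'k alg_closure) \<Rightarrow> 'k alg_closure" where
  "mpoly_eval f x =
     (\<Sum>m\<in>Poly_Mapping.keys f. to_ac (Poly_Mapping.lookup f m) * (\<Prod>i\<in>UNIV. x i ^ Poly_Mapping.lookup m i))"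

definition weighted_homogeneous ::
  "('n::finite \<Rightarrow> nat) \<Rightarrow> nat \<Rightarrow> ('n, 'k::field) mpoly \<Rightarrow> bool" where
  "weighted_homogeneous w D f \<longleftrightarrow>
     (\<forall>m\<in>Poly_Mapping.keys f. (\<Sum>i\<in>UNIV. w i * Poly_Mapping.lookup m i) = D)"

definition Gm :: "'a::field set \<Rightarrow> 'a monoid" where
  "Gm K = \<lparr>carrier = K - {0}, monoid.mult = (*), one = 1\<rparr>"

definition wact :: "('n \<Rightarrow> nat) \<Rightarrow> 'a::field \<Rightarrow> ('n \<Rightarrow> 'a) \<Rightarrow> ('n \<Rightarrow> 'a)" where
  "wact w c x = (\<lambda>i. c ^ w i * x i)"

definition punctured_cone ::
  "('n::finite, 'k::field) mpoly \<Rightarrow> 'k alg_closure set \<Rightarrow> ('n \<Rightarrow> 'k alg_closure) set" where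
  "punctured_cone f K = {x. (\<forall>i. x i \<in> K) \<and> x \<noteq> (\<lambda>i. 0) \<and> mpoly_eval f x = 0}"


subsection \<open>Points of the coarse variety\<close>

definition geometric_points ::
  "('n::finite \<Rightarrow> nat) \<Rightarrow> ('n, 'k::field) mpoly \<Rightarrow> ('n \<Rightarrow> 'k alg_closure) set set" where
  "geometric_points w f = orbits (Gm UNIV) (punctured_cone f UNIV) (wact w)"

text \<open>
  The \<open>\<F>\<^bsub>q^r\<^esub>\<close>-points of the coarse variety are its geometric points fixed by the
  \<open>q ^ r\<close>-power Frobenius. Such a point is an orbit under the multiplicative group of the
  algebraic closure; that it contains a vector over \<open>\<F>\<^bsub>q^r\<^esub>\<close> is a theorem, not part of
  the definition.
\<close>

definition coarse_points ::
  "('n::finite \<Rightarrow> nat) \<Rightarrow> ('n, 'k::{field,finite}) mpoly \<Rightarrow> nat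
     \<Rightarrow> ('n \<Rightarrow> 'k alg_closure) set set" where
  "coarse_points w f r =
     {P \<in> geometric_points w f. (\<lambda>x i. x i ^ (CARD('k) ^ r)) ` P = P}"

definition supp :: "('n \<Rightarrow> 'a::zero) \<Rightarrow> 'n set" where
  "supp x = {i. x i \<noteq> 0}"

definition support_of :: "('n \<Rightarrow> 'a::zero) set \<Rightarrow> 'n set" where
  "support_of P = supp (SOME x. x \<in> P)"

definition support_gcd :: "('n \<Rightarrow> nat) \<Rightarrow> 'n set \<Rightarrow> nat" where
  "support_gcd w S = Gcd (w ` S)"

definition g_point ::
  "('n \<Rightarrow> nat) \<Rightarrow> nat \<Rightarrow> ('n \<Rightarrow> 'k::{field,finite} alg_closure) set \<Rightarrow> nat" where
  "g_point w r P = gcd (support_gcd w (support_of P)) (CARD('k) ^ r - 1)"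


subsection \<open>Twists and the groupoid entropy\<close>

definition twists ::
  "('n::finite \<Rightarrow> nat) \<Rightarrow> ('n, 'k::{field,finite}) mpoly \<Rightarrow> nat
     \<Rightarrow> ('n \<Rightarrow> 'k alg_closure) set set" where
  "twists w f r = orbits (Gm (Fqr r)) (punctured_cone f (Fqr r)) (wact w)"

text \<open>
  In the quotient groupoid, the automorphism group of an orbit is the stabilizer of a
  representative; the choice is immaterial, see \<open>twist_aut_orbit\<close> below.
\<close>

definition twist_aut ::
  "('n \<Rightarrow> nat) \<Rightarrow> nat \<Rightarrow> ('n \<Rightarrow> 'k::{field,finite} alg_closure) set \<Rightarrow> 'k alg_closure set" where
  "twist_aut w r \<xi> = stabilizer (Gm (Fqr r)) (wact w) (SOME x. x \<in> \<xi>)"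

definition mass ::
  "('n \<Rightarrow> nat) \<Rightarrow> nat \<Rightarrow> ('n \<Rightarrow> 'k::{field,finite} alg_closure) set \<Rightarrow> real" where
  "mass w r \<xi> = 1 / real (card (twist_aut w r \<xi>))"

definition mass_prob ::
  "('n::finite \<Rightarrow> nat) \<Rightarrow> ('n, 'k::{field,finite}) mpoly \<Rightarrow> nat
     \<Rightarrow> ('n \<Rightarrow> 'k alg_closure) set \<Rightarrow> real" where
  "mass_prob w f r \<xi> = mass w r \<xi> / (\<Sum>\<eta>\<in>twists w f r. mass w r \<eta>)"

definition groupoid_entropy ::
  "('n::finite \<Rightarrow> nat) \<Rightarrow> ('n, 'k::{field,finite}) mpoly \<Rightarrow> nat \<Rightarrow> real" where
  "groupoid_entropy w f r =
     - (\<Sum>\<xi>\<in>twists w f r. mass_prob w f r \<xi> * ln (mass_prob w f r \<xi>))"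

text \<open>The coarse point lying under a twist.\<close>

definition coarse_of ::
  "('n \<Rightarrow> nat) \<Rightarrow> ('n \<Rightarrow> 'k::field alg_closure) set \<Rightarrow> ('n \<Rightarrow> 'k alg_closure) set" where
  "coarse_of w \<xi> = (\<Union>x\<in>\<xi>. orbit (Gm UNIV) (wact w) x)"


subsection \<open>Probabilistic height\<close>

definition prob_height_vec ::
  "('n::finite \<Rightarrow> nat) \<Rightarrow> ('n, 'k::{field,finite}) mpoly \<Rightarrow> nat
     \<Rightarrow> ('n \<Rightarrow> 'k alg_closure) \<Rightarrow> real" where
  "prob_height_vec w f r x =
     - ln (real (card (orbit (Gm (Fqr r)) (wact w) x)) / real (card (punctured_cone f (Fqr r))))"

definition prob_height ::
  "('n::finite \<Rightarrow> nat) \<Rightarrow> ('n, 'k::{field,finite}) mpoly \<Rightarrow> nat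
     \<Rightarrow> ('n \<Rightarrow> 'k alg_closure) set \<Rightarrow> real" where
  "prob_height w f r P = prob_height_vec w f r (SOME x. x \<in> P \<and> x \<in> punctured_cone f (Fqr r))"


subsection \<open>Independence of the chosen representatives\<close>

lemma supp_wact: "c \<noteq> 0 \<Longrightarrow> supp (wact w c x) = supp x"
  by (auto simp: supp_def wact_def)

lemma support_of_orbit:
  assumes "1 \<in> K"
  shows "support_of (orbit (Gm K) (wact w) x) = supp x"
proof -
  have "x \<in> orbit (Gm K) (wact w) x"
    using assms by (force simp: orbit_def Gm_def wact_def)
  hence "(SOME y. y \<in> orbit (Gm K) (wact w) x) \<in> orbit (Gm K) (wact w) x"
    by (rule someI[where P = "\<lambda>y. y \<in> orbit (Gm K) (wact w) x"])
  thus ?thesis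
    unfolding support_of_def by (auto simp: orbit_def Gm_def supp_wact)
qed

lemma twist_aut_orbit:
  "twist_aut w r (orbit (Gm (Fqr r)) (wact w) x) = stabilizer (Gm (Fqr r)) (wact w) x"
proof -
  let ?O = "orbit (Gm (Fqr r)) (wact w) x"
  have "x \<in> ?O"
    by (auto simp: orbit_def Gm_def wact_def Fqr_def intro!: exI[of _ 1])
  hence "(SOME y. y \<in> ?O) \<in> ?O"
    by (rule someI[where P = "\<lambda>y. y \<in> ?O"])
  then obtain c where c: "c \<noteq> 0" "(SOME y. y \<in> ?O) = wact w c x"
    by (auto simp: orbit_def Gm_def)
  have "wact w a (wact w c x) = wact w c x \<longleftrightarrow> wact w a x = x" for a
    using c(1) by (auto simp: wact_def fun_eq_iff mult.left_commute)
  thus ?thesis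
    by (simp add: twist_aut_def stabilizer_def c(2))
qed

end

theory Submission
  imports Defs "HOL-Number_Theory.Residues"
begin

text \<open>
  Write \<open>Q = q ^ r\<close> and \<open>N = |X(\<F>\<^sub>Q)|\<close>. Everything follows by counting vectors over \<open>\<F>\<^sub>Q\<close> on the
  punctured cone. For a vector \<open>x\<close> let \<open>k\<close> be the gcd of the weights on its support. Then nonzero scalars
  \<open>a\<close> and \<open>b\<close> move \<open>x\<close> to the same vector iff \<open>a ^ k = b ^ k\<close> (\<open>wact_eq_iff\<close>). Three facts carry
  the argument.

    \<^item> The stabilizer of \<open>x\<close> in \<open>\<F>\<^sub>Q\<^sup>\<times>\<close> is the group of solutions of \<open>c ^ k = 1 = c ^ (Q - 1)\<close>, that is
      of \<open>c ^ g = 1\<close> with \<open>g = gcd k (Q - 1)\<close>. As \<open>g\<close> divides \<open>Q - 1\<close>, it is prime to the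
      characteristic, so there are exactly \<open>g\<close> solutions (\<open>card_stabilizer\<close>).

    \<^item> By descent, every coarse point fixed by Frobenius contains a vector over \<open>\<F>\<^sub>Q\<close>
      (\<open>coarse_points_eq\<close>). This is the theorem of Lang for \<open>\<G>\<^sub>m\<close>, made explicit by taking a \<open>(Q - 1)\<close>-th root.

    \<^item> A translate of \<open>x\<close> by \<open>c\<close> is again defined over \<open>\<F>\<^sub>Q\<close> iff \<open>c ^ k \<in> \<F>\<^sub>Q\<close>. Hence \<open>c ^ k\<close>
      parametrizes the \<open>\<F>\<^sub>Q\<close>-vectors in a coarse point by \<open>\<F>\<^sub>Q\<^sup>\<times>\<close>, and there are \<open>Q - 1\<close> of them
      whatever \<open>k\<close> is (\<open>card_point_fibre\<close>).

  By the orbit-stabilizer theorem the mass of a twist is its number of vectors divided by \<open>Q - 1\<close>.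
  Hence the mass measure pushes forward to the counting measure on coarse points
  (\<open>sum_mass_coarse\<close>): every coarse point has mass \<open>1\<close>, and the total mass is \<open>N\<close>. A twist over \<open>P\<close>
  thus has probability \<open>1 / (N * g P)\<close>, and its orbit also makes up the fraction \<open>1 / (N * g P)\<close> of
  the cone. So the negative logarithm of the probability is the height \<open>ln N + ln (g P)\<close>,
  and the three formulas for the entropy are one.

  For the comparison with \<open>w' = w / d\<close>, every nonzero element of the algebraic closure is a \<open>d\<close>-th
  power, so both weights have the same geometric orbits and the same coarse points, while \<open>k\<close> becomes
  \<open>k / d\<close>. The entropies therefore differ by the mean of \<open>ln (g P) - ln (g' P)\<close>, and each term is
  controlled by the divisibilities \<open>gcd k' m dvd gcd (d k') m dvd gcd d m * gcd k' m\<close> with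
  \<open>m = Q - 1\<close>, the last one being an equality when \<open>d\<close> and \<open>k'\<close> are coprime.
\<close>

section \<open>Roots of unity in an algebraically closed field\<close>

text \<open>
  The polynomial \<open>X ^ n - 1\<close> splits into linear factors, and a repeated root \<open>a\<close> would also be a
  root of its derivative \<open>n X ^ (n - 1)\<close>, which vanishes only at \<open>0\<close>.
\<close>

lemma card_roots_of_unity:
  assumes "of_nat n \<noteq> (0::'a::alg_closed_field)"
  shows "card {c::'a. c ^ n = 1} = n"
proof -
  have n: "n > 0"
    using assms by (cases n) auto
  define p :: "'a poly" where "p = monom 1 n - 1"
  have poly_p: "poly p c = c ^ n - 1" for c
    by (simp add: p_def poly_monom)
  have "poly p 0 \<noteq> 0"
    using n by (simp add: poly_p power_0_left)
  hence "p \<noteq> 0"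
    by auto
  have deg: "degree p = n"
    unfolding p_def using n
    by (metis degree_add_eq_left degree_1 degree_minus degree_monom_eq diff_conv_add_uminus zero_neq_one)
  obtain A where A: "size A = degree p" "p = smult (lead_coeff p) (\<Prod>x\<in>#A. [:-x, 1:])"
    using alg_closed_imp_factorization[OF \<open>p \<noteq> 0\<close>] by blast
  have roots: "set_mset A = {c. c ^ n = 1}"
  proof -
    have "poly p c = 0 \<longleftrightarrow> c \<in># A" for c
      using \<open>p \<noteq> 0\<close> by (subst A(2)) (auto simp: poly_prod_mset prod_mset_zero_iff)
    thus ?thesis
      by (auto simp: poly_p)
  qed
  have "count A a \<le> 1" for a
  proof (rule ccontr)
    assume "\<not> count A a \<le> 1"
    hence "{#a, a#} \<subseteq># A"
      by (auto simp: subseteq_mset_def)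
    then obtain B where B: "A = {#a, a#} + B"
      by (metis mset_subset_eq_exists_conv)
    define q where "q = smult (lead_coeff p) (\<Prod>x\<in>#B. [:-x, 1:])"
    have "p = [:-a, 1:] * ([:-a, 1:] * q)"
      by (subst A(2)) (simp add: B q_def del: mult_pCons_left)
    hence "poly (pderiv p) a = 0"
      by (simp only: pderiv_mult poly_add poly_mult) simp
    moreover have "poly (pderiv p) a = of_nat n * a ^ (n - 1)"
      by (simp add: p_def pderiv_diff pderiv_monom poly_monom)
    ultimately have "a = 0"
      using assms by (auto split: if_splits)
    moreover have "a \<in> set_mset A"
      by (simp add: B)
    ultimately show False
      using n roots by (simp add: power_0_left)
  qed
  \<comment> \<open>A multiset without repetitions has as many members as its underlying set.\<close>
  hence "A = mset_set (set_mset A)"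
    by (intro multiset_eqI) (metis One_nat_def count_eq_zero_iff count_mset_set(1) count_mset_set(3) finite_set_mset le_0_eq le_Suc_eq)
  thus ?thesis
    by (metis A(1) deg roots size_mset_set)
qed

lemma power_gcd_eq_1_iff:
  fixes c :: "'a::field"
  shows "c ^ gcd m n = 1 \<longleftrightarrow> c ^ m = 1 \<and> c ^ n = 1"
proof
  assume "c ^ gcd m n = 1"
  thus "c ^ m = 1 \<and> c ^ n = 1"
    by (metis dvd_def gcd_dvd1 gcd_dvd2 power_mult power_one)
next
  assume *: "c ^ m = 1 \<and> c ^ n = 1"
  show "c ^ gcd m n = 1"
  proof (cases "m = 0")
    case False
    then obtain x y where "m * x = n * y + gcd m n"
      using bezout_nat by blast
    hence "(c ^ m) ^ x = (c ^ n) ^ y * c ^ gcd m n"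
      by (metis power_add power_mult)
    thus ?thesis
      using * by simp
  qed (use * in auto)
qed

text \<open>
  This condenses the conditions \<open>c ^ w i = 1\<close>, one for each \<open>i\<close> in the support of a vector, into a
  single condition on the gcd of those weights.
\<close>

lemma power_Gcd_eq_1_iff:
  fixes c :: "'a::field"
  assumes "finite A"
  shows "c ^ Gcd A = 1 \<longleftrightarrow> (\<forall>n\<in>A. c ^ n = 1)"
  using assms by induction (auto simp: power_gcd_eq_1_iff)


section \<open>The subfield with \<open>q ^ r\<close> elements\<close>

lemma card_field_gt_1: "CARD('k::{field,finite}) > 1"
proof -
  have "card {0, 1 :: 'k} \<le> CARD('k)"
    by (rule card_mono) auto
  thus ?thesis
    by simp
qed

lemma card_power_gt_1: "r > 0 \<Longrightarrow> CARD('k::{field,finite}) ^ r > 1"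
  using card_field_gt_1 by (intro one_less_power) auto

text \<open>
  All divisors of \<open>q ^ r - 1\<close> are thereby units in the algebraic closure, which makes their roots of
  unity easy to count.
\<close>

lemma of_nat_card_power_minus_1:
  assumes "r > 0"
  shows "of_nat (CARD('k) ^ r - 1) = (- 1 :: 'k::{field,finite} alg_closure)"
proof -
  have "of_nat CARD('k) = (0::'k)"
    by (simp add: of_nat_eq_0_iff_char_dvd CHAR_dvd_CARD)
  hence "of_nat CARD('k) = (0::'k alg_closure)"
    by (metis to_ac_0 to_ac_of_nat)
  hence "of_nat (CARD('k) ^ r) = (0::'k alg_closure)"
    using assms by simp
  moreover have "CARD('k) ^ r = Suc (CARD('k) ^ r - 1)"
    using card_power_gt_1[of r] assms by simp
  ultimately show ?thesis
    by (metis add_eq_0_iff of_nat_Suc)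
qed

lemma card_roots_of_unity_dvd:
  assumes "r > 0" "n dvd CARD('k) ^ r - 1"
  shows "card {c :: 'k::{field,finite} alg_closure. c ^ n = 1} = n"
proof (rule card_roots_of_unity)
  obtain m where "CARD('k) ^ r - 1 = n * m"
    using assms(2) by blast
  hence "of_nat n * of_nat m = (- 1 :: 'k alg_closure)"
    using of_nat_card_power_minus_1[OF assms(1)] by (metis of_nat_mult)
  thus "of_nat n \<noteq> (0 :: 'k alg_closure)"
    by auto
qed

lemma power_eq_self_iff:
  fixes c :: "'a::field"
  assumes "n \<ge> 1"
  shows "c ^ n = c \<longleftrightarrow> c = 0 \<or> c ^ (n - 1) = 1"
  using assms by (cases n) auto

lemma Fqr_units:
  "r > 0 \<Longrightarrow> Fqr r - {0} = {c :: 'k::{field,finite} alg_closure. c ^ (CARD('k) ^ r - 1) = 1}"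
  using card_power_gt_1[of r, where ?'k = 'k]
  by (auto simp: Fqr_def power_eq_self_iff power_0_left)

lemma card_Fqr_units:
  "r > 0 \<Longrightarrow> card (Fqr r - {0 :: 'k::{field,finite} alg_closure}) = CARD('k) ^ r - 1"
  by (simp add: Fqr_units card_roots_of_unity_dvd)

lemma finite_Fqr:
  assumes "r > 0"
  shows "finite (Fqr r :: 'k::{field,finite} alg_closure set)"
proof -
  have "card (Fqr r - {0 :: 'k alg_closure}) > 0"
    using card_Fqr_units[OF assms, where ?'k = 'k] card_power_gt_1[OF assms, where ?'k = 'k] by simp
  thus ?thesis
    by (metis card_gt_0_iff finite_Diff2 finite.emptyI finite_insert)
qed


section \<open>The weighted action\<close>

lemma Fqr_mult: "a \<in> Fqr r \<Longrightarrow> b \<in> Fqr r \<Longrightarrow> a * b \<in> Fqr r"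
  and Fqr_inverse: "a \<in> Fqr r \<Longrightarrow> inverse a \<in> Fqr r"
  and Fqr_power: "a \<in> Fqr r \<Longrightarrow> a ^ n \<in> Fqr r"
  and Fqr_1: "1 \<in> Fqr r"
  by (auto simp: Fqr_def power_mult_distrib power_inverse) (metis power_commutes power_mult mult.commute)

lemma wact_wact: "wact w a (wact w b x) = wact w (a * b) x"
  by (simp add: wact_def power_mult_distrib mult.assoc)

lemma wact_1 [simp]: "wact w 1 x = x"
  by (simp add: wact_def)

text \<open>
  Both facts below reduce the weighted action on a single vector to the action of a single power
  map: only the gcd of the weights on the support matters.
\<close>

lemma wact_eq_self_iff:
  fixes w :: "'n::finite \<Rightarrow> nat"
  shows "wact w c x = x \<longleftrightarrow> c ^ support_gcd w (supp x) = 1"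
  unfolding support_gcd_def
  by (subst power_Gcd_eq_1_iff) (auto simp: wact_def supp_def fun_eq_iff)

lemma wact_eq_iff:
  fixes w :: "'n::finite \<Rightarrow> nat"
  assumes "a \<noteq> 0" "b \<noteq> 0"
  shows "wact w a x = wact w b x \<longleftrightarrow> a ^ support_gcd w (supp x) = b ^ support_gcd w (supp x)"
proof -
  have "wact w a x = wact w b x \<longleftrightarrow> wact w (a / b) x = x"
  proof
    assume "wact w a x = wact w b x"
    hence "wact w (inverse b) (wact w a x) = wact w (inverse b) (wact w b x)"
      by simp
    thus "wact w (a / b) x = x"
      using assms by (simp add: wact_wact field_simps)
  next
    assume "wact w (a / b) x = x"
    hence "wact w b (wact w (a / b) x) = wact w b x"
      by simp
    thus "wact w a x = wact w b x"
      using assms by (simp add: wact_wact)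
  qed
  thus ?thesis
    using assms by (simp add: wact_eq_self_iff power_divide)
qed

text \<open>
  The action is regarded on the space of all vectors rather than on the cone. Orbits and stabilizers
  do not change, and maps on \<open>UNIV\<close> are trivially extensional, as \<^term>\<open>BijGroup\<close> demands.
\<close>

lemma wact_group_action:
  assumes "1 \<in> K" "\<And>a b. a \<in> K \<Longrightarrow> b \<in> K \<Longrightarrow> a * b \<in> K" "\<And>a. a \<in> K \<Longrightarrow> inverse a \<in> K"
  shows "group_action (Gm K) UNIV (wact w)"
proof -
  have "group (Gm K)"
  proof (rule groupI)
    fix a assume "a \<in> carrier (Gm K)"
    thus "\<exists>b\<in>carrier (Gm K). b \<otimes>\<^bsub>Gm K\<^esub> a = \<one>\<^bsub>Gm K\<^esub>"
      using assms(3) by (intro bexI[of _ "inverse a"]) (auto simp: Gm_def)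
  qed (use assms in \<open>auto simp: Gm_def mult.assoc\<close>)
  moreover have "bij (wact w c)" if "c \<noteq> 0" for c :: 'a
    using that by (intro o_bij[of "wact w (inverse c)"]) (auto simp: wact_wact fun_eq_iff)
  hence "wact w \<in> hom (Gm K) (BijGroup UNIV)"
    by (auto simp: hom_def BijGroup_def Bij_def Gm_def wact_wact fun_eq_iff compose_def)
  ultimately show ?thesis
    by (simp add: group_action_def group_hom_def group_hom_axioms_def group_BijGroup)
qed

interpretation geom: group_action "Gm UNIV" UNIV "wact w" for w
  by (rule wact_group_action) auto

interpretation rat: group_action "Gm (Fqr r)" UNIV "wact w" for w r
  by (rule wact_group_action) (auto simp: Fqr_mult Fqr_inverse Fqr_1)

lemma (in group_action) orbit_eq_iff:
  assumes "x \<in> E" "y \<in> E"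
  shows "orbit G \<phi> y = orbit G \<phi> x \<longleftrightarrow> y \<in> orbit G \<phi> x"
proof
  assume y: "y \<in> orbit G \<phi> x"
  have "orbit G \<phi> z \<subseteq> E" if "z \<in> E" for z
    using that element_image by (auto simp: orbit_def)
  thus "orbit G \<phi> y = orbit G \<phi> x"
    using assms y orbit_trans orbit_sym by (meson subsetD subsetI subset_antisym)
qed (use assms orbit_refl in blast)

lemma mpoly_eval_wact:
  assumes "weighted_homogeneous w D f"
  shows "mpoly_eval f (wact w c x) = c ^ D * mpoly_eval f x"
proof -
  have "(\<Prod>i\<in>UNIV. wact w c x i ^ Poly_Mapping.lookup m i) =
          c ^ D * (\<Prod>i\<in>UNIV. x i ^ Poly_Mapping.lookup m i)" if "m \<in> Poly_Mapping.keys f" for m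
  proof -
    have "(\<Prod>i\<in>UNIV. wact w c x i ^ Poly_Mapping.lookup m i) =
            (\<Prod>i\<in>UNIV. c ^ (w i * Poly_Mapping.lookup m i)) * (\<Prod>i\<in>UNIV. x i ^ Poly_Mapping.lookup m i)"
      by (simp add: wact_def power_mult_distrib power_mult prod.distrib)
    also have "(\<Prod>i\<in>UNIV. c ^ (w i * Poly_Mapping.lookup m i)) = c ^ D"
      using assms that by (simp add: weighted_homogeneous_def flip: power_sum)
    finally show ?thesis .
  qed
  thus ?thesis
    by (simp add: mpoly_eval_def sum_distrib_left mult.left_commute)
qed

lemma wact_in_punctured_cone_UNIV:
  assumes "weighted_homogeneous w D f" "c \<noteq> 0" "x \<in> punctured_cone f UNIV"
  shows "wact w c x \<in> punctured_cone f UNIV"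
proof -
  have "mpoly_eval f (wact w c x) = 0"
    using assms by (simp add: mpoly_eval_wact punctured_cone_def)
  moreover have "wact w c x \<noteq> (\<lambda>i. 0)"
    using assms by (auto simp: punctured_cone_def fun_eq_iff wact_def)
  ultimately show ?thesis
    by (simp add: punctured_cone_def)
qed


section \<open>Counting on a weighted hypersurface\<close>

lemma sum_over_fibres:
  fixes h :: "'b \<Rightarrow> real"
  assumes "finite A"
  shows "(\<Sum>y\<in>g ` A. h y * real (card {x\<in>A. g x = y})) = (\<Sum>x\<in>A. h (g x))"
proof -
  have "(\<Sum>x\<in>A. h (g x)) = (\<Sum>y\<in>g ` A. \<Sum>x | x \<in> A \<and> g x = y. h (g x))"
    by (rule sum.image_gen[OF assms])
  also have "\<dots> = (\<Sum>y\<in>g ` A. \<Sum>x | x \<in> A \<and> g x = y. h y)"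
    by (intro sum.cong) auto
  finally show ?thesis
    by (simp add: mult.commute)
qed

locale weighted_hypersurface =
  fixes w :: "'n::finite \<Rightarrow> nat"
    and f :: "('n, 'k::{field,finite}) mpoly"
    and D r :: nat
  assumes weights_pos: "w i > 0"
    and homogeneous: "weighted_homogeneous w D f"
    and r_pos: "r > 0"
begin

abbreviation "cone \<equiv> punctured_cone f (Fqr r)"
abbreviation "twist_of \<equiv> orbit (Gm (Fqr r)) (wact w) :: ('n \<Rightarrow> 'k alg_closure) \<Rightarrow> _"
abbreviation "point_of \<equiv> orbit (Gm UNIV) (wact w) :: ('n \<Rightarrow> 'k alg_closure) \<Rightarrow> _"

lemma field_size_gt_1: "CARD('k) ^ r > 1"
  using r_pos by (rule card_power_gt_1)

lemma finite_cone: "finite cone"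
proof (rule finite_subset)
  show "cone \<subseteq> PiE UNIV (\<lambda>_. Fqr r)"
    by (auto simp: punctured_cone_def)
  show "finite (PiE (UNIV :: 'n set) (\<lambda>_. Fqr r :: 'k alg_closure set))"
    by (intro finite_PiE) (auto simp: finite_Fqr r_pos)
qed

lemma mem_point_of: "y \<in> point_of x \<longleftrightarrow> (\<exists>c. c \<noteq> 0 \<and> y = wact w c x)"
  by (auto simp: orbit_def Gm_def)

lemma mem_twist_of: "y \<in> twist_of x \<longleftrightarrow> (\<exists>c\<in>Fqr r. c \<noteq> 0 \<and> y = wact w c x)"
  by (auto simp: orbit_def Gm_def)

lemma cone_iff: "x \<in> cone \<longleftrightarrow> x \<in> punctured_cone f UNIV \<and> (\<forall>i. x i \<in> Fqr r)"
  by (auto simp: punctured_cone_def)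

lemma twist_of_subset_cone: "x \<in> cone \<Longrightarrow> twist_of x \<subseteq> cone"
  using wact_in_punctured_cone_UNIV[OF homogeneous]
  by (auto simp: mem_twist_of cone_iff) (auto simp: wact_def Fqr_mult Fqr_power)

lemma support_gcd_pos:
  assumes "x \<in> cone"
  shows "support_gcd w (supp x) > 0"
proof -
  obtain i where "x i \<noteq> 0"
    using assms by (auto simp: punctured_cone_def)
  thus ?thesis
    using weights_pos[of i] by (auto simp: support_gcd_def supp_def image_subset_iff intro!: Nat.gr0I)
qed

lemma g_point_point_of: "g_point w r (point_of x) = gcd (support_gcd w (supp x)) (CARD('k) ^ r - 1)"
  by (simp add: g_point_def support_of_orbit)

lemma g_point_pos: "g_point w r (P :: ('n \<Rightarrow> 'k alg_closure) set) > 0"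
  using field_size_gt_1 by (simp add: g_point_def)

text \<open>
  The stabilizer is cut out by \<open>c ^ k = 1\<close> and \<open>c ^ (q ^ r - 1) = 1\<close>; together these say that \<open>c\<close>
  is a root of unity of order dividing \<open>gcd k (q ^ r - 1)\<close>.
\<close>

lemma card_stabilizer: "card (stabilizer (Gm (Fqr r)) (wact w) x) = g_point w r (point_of x)"
proof -
  have "stabilizer (Gm (Fqr r)) (wact w) x = {c. c ^ g_point w r (point_of x) = 1}"
    unfolding g_point_point_of power_gcd_eq_1_iff
    using Fqr_units[OF r_pos, where ?'k = 'k] by (auto simp: stabilizer_def Gm_def wact_eq_self_iff)
  moreover have "card {c :: 'k alg_closure. c ^ g_point w r (point_of x) = 1} = g_point w r (point_of x)"
    unfolding g_point_point_of by (intro card_roots_of_unity_dvd[OF r_pos] gcd_dvd2)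
  ultimately show ?thesis
    by simp
qed

lemma order_Gm: "Coset.order (Gm (Fqr r :: 'k alg_closure set)) = CARD('k) ^ r - 1"
  using card_Fqr_units[OF r_pos, where ?'k = 'k] by (simp add: Coset.order_def Gm_def)

lemma card_twist_of: "card (twist_of x) * g_point w r (point_of x) = CARD('k) ^ r - 1"
  using rat.orbit_stabilizer_theorem[of x r w]
  by (simp add: card_stabilizer order_Gm)

lemma frobenius_wact: "(\<lambda>i. wact w c x i ^ CARD('k) ^ r) = wact w (c ^ CARD('k) ^ r) (\<lambda>i. x i ^ CARD('k) ^ r)"
  by (simp add: wact_def power_mult_distrib mult.commute flip: power_mult)

lemma frobenius_cone: "x \<in> cone \<Longrightarrow> (\<lambda>i. x i ^ CARD('k) ^ r) = x"
  by (simp add: punctured_cone_def Fqr_def)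

text \<open>
  Descent, with \<open>Q = q ^ r\<close>: if the \<open>Q\<close>-power Frobenius sends \<open>x\<close> to \<open>c \<cdot> x\<close>, then it sends \<open>b \<cdot> x\<close> to \<open>(b ^ Q * c) \<cdot> x\<close>,
  so \<open>b \<cdot> x\<close> is fixed once \<open>b ^ (Q - 1) = inverse c\<close>. Such a \<open>b\<close> exists in the
  algebraic closure. Conversely, an orbit through a fixed vector is mapped onto itself because
  every element has a \<open>Q\<close>-th root.
\<close>

lemma coarse_points_eq: "coarse_points w f r = point_of ` cone"
proof (intro equalityI subsetI)
  fix P assume P: "P \<in> coarse_points w f r"
  then obtain x where x: "x \<in> punctured_cone f UNIV" "P = point_of x"
    by (auto simp: coarse_points_def geometric_points_def orbits_def)
  have "(\<lambda>i. x i ^ CARD('k) ^ r) \<in> P"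
    using P geom.orbit_refl[of x w] x(2) by (auto simp: coarse_points_def)
  then obtain c where c: "c \<noteq> 0" "(\<lambda>i. x i ^ CARD('k) ^ r) = wact w c x"
    by (auto simp: x(2) mem_point_of)
  obtain b where b: "b ^ (CARD('k) ^ r - 1) = inverse c"
    using nth_root_exists[of "CARD('k) ^ r - 1" "inverse c"] field_size_gt_1 by auto
  have "b \<noteq> 0"
    using b c(1) field_size_gt_1 by (auto simp: power_0_left)
  have "b ^ CARD('k) ^ r = b * inverse c"
    using field_size_gt_1 b by (metis One_nat_def not_one_less_zero power_minus_mult mult.commute not_gr_zero)
  hence "(\<lambda>i. wact w b x i ^ CARD('k) ^ r) = wact w b x"
    using c(1) by (simp add: frobenius_wact c(2) wact_wact mult.assoc)
  hence "wact w b x \<in> cone"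
    using wact_in_punctured_cone_UNIV[OF homogeneous \<open>b \<noteq> 0\<close> x(1)]
    by (simp add: cone_iff) (simp add: Fqr_def fun_eq_iff)
  moreover have "point_of (wact w b x) = P"
    unfolding x(2) using \<open>b \<noteq> 0\<close> by (subst geom.orbit_eq_iff) (auto simp: mem_point_of)
  ultimately show "P \<in> point_of ` cone"
    by blast
next
  fix P assume "P \<in> point_of ` cone"
  then obtain x where x: "x \<in> cone" "P = point_of x"
    by blast
  have x_fix: "(\<lambda>i. x i ^ CARD('k) ^ r) = x"
    using x(1) by (rule frobenius_cone)
  have "(\<lambda>x i. x i ^ CARD('k) ^ r) ` P = P"
  proof (intro equalityI subsetI)
    fix y assume "y \<in> (\<lambda>x i. x i ^ CARD('k) ^ r) ` P"
    then obtain c where "c \<noteq> 0" "y = (\<lambda>i. wact w c x i ^ CARD('k) ^ r)"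
      by (auto simp: x(2) mem_point_of)
    thus "y \<in> P"
      unfolding frobenius_wact x_fix x(2) mem_point_of by (metis power_not_zero)
  next
    fix y assume "y \<in> P"
    then obtain c where c: "c \<noteq> 0" "y = wact w c x"
      by (auto simp: x(2) mem_point_of)
    obtain b where b: "b ^ CARD('k) ^ r = c"
      using nth_root_exists[of "CARD('k) ^ r" c] field_size_gt_1 by auto
    have "b \<noteq> 0"
      using b c(1) field_size_gt_1 by (auto simp: power_0_left)
    hence "wact w b x \<in> P"
      by (auto simp: x(2) mem_point_of)
    moreover have "y = (\<lambda>i. wact w b x i ^ CARD('k) ^ r)"
      by (simp add: frobenius_wact x_fix b c(2))
    ultimately show "y \<in> (\<lambda>x i. x i ^ CARD('k) ^ r) ` P"
      by blast
  qed
  thus "P \<in> coarse_points w f r"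
    using x by (auto simp: coarse_points_def geometric_points_def orbits_def cone_iff)
qed

lemma finite_coarse_points: "finite (coarse_points w f r)"
  by (simp add: coarse_points_eq finite_cone)

lemma wact_mem_cone_iff:
  assumes x: "x \<in> cone" and c: "c \<noteq> 0"
  shows "wact w c x \<in> cone \<longleftrightarrow> c ^ support_gcd w (supp x) \<in> Fqr r"
proof -
  have x_fix: "(\<lambda>i. x i ^ CARD('k) ^ r) = x"
    using x by (rule frobenius_cone)
  have "wact w c x \<in> cone \<longleftrightarrow> (\<lambda>i. wact w c x i ^ CARD('k) ^ r) = wact w c x"
    using wact_in_punctured_cone_UNIV[OF homogeneous c, of x] x
    by (simp add: cone_iff) (simp add: Fqr_def fun_eq_iff)
  also have "\<dots> \<longleftrightarrow> wact w (c ^ CARD('k) ^ r) x = wact w c x"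
    by (simp only: frobenius_wact x_fix)
  also have "\<dots> \<longleftrightarrow> c ^ support_gcd w (supp x) \<in> Fqr r"
    using c by (simp add: wact_eq_iff Fqr_def mult.commute flip: power_mult)
  finally show ?thesis .
qed

text \<open>
  The translates of \<open>x\<close> over the small field correspond to their invariant \<open>c ^ k\<close>, which ranges over
  all nonzero elements of the field. Counting the scalars \<open>c\<close> themselves would be awkward:
  the number of \<open>k\<close>-th roots of a nonzero element is smaller than \<open>k\<close> if the characteristic divides \<open>k\<close>.
  Choosing one root of each element avoids this.
\<close>

lemma card_point_fibre:
  assumes x: "x \<in> cone"
  shows "card {y\<in>cone. point_of y = point_of x} = CARD('k) ^ r - 1"
proof -
  let ?k = "support_gcd w (supp x)"
  have k: "?k > 0"
    using x by (rule support_gcd_pos)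
  define root where "root a = (SOME c. c ^ ?k = a)" for a :: "'k alg_closure"
  have root: "root a ^ ?k = a" for a
    unfolding root_def using nth_root_exists[OF k] by (rule someI_ex)
  have root_nz: "root a \<noteq> 0" if "a \<noteq> 0" for a
    using root[of a] that k by (auto simp: power_0_left)
  have "bij_betw (\<lambda>a. wact w (root a) x) (Fqr r - {0}) {y\<in>cone. point_of y = point_of x}"
  proof (intro bij_betw_imageI inj_onI equalityI subsetI)
    fix a b assume "a \<in> Fqr r - {0}" "b \<in> Fqr r - {0}" "wact w (root a) x = wact w (root b) x"
    thus "a = b"
      by (simp add: wact_eq_iff root_nz root)
  next
    fix y assume "y \<in> (\<lambda>a. wact w (root a) x) ` (Fqr r - {0})"
    then obtain a where a: "a \<in> Fqr r" "a \<noteq> 0" "y = wact w (root a) x"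
      by blast
    thus "y \<in> {y\<in>cone. point_of y = point_of x}"
      using wact_mem_cone_iff[OF x root_nz[OF a(2)]] root_nz[OF a(2)]
      by (auto simp: root geom.orbit_eq_iff mem_point_of)
  next
    fix y assume y: "y \<in> {y\<in>cone. point_of y = point_of x}"
    then obtain c where c: "c \<noteq> 0" "y = wact w c x"
      by (auto simp: geom.orbit_eq_iff mem_point_of)
    hence a: "c ^ ?k \<in> Fqr r - {0}"
      using y wact_mem_cone_iff[OF x c(1)] by auto
    moreover have "y = wact w (root (c ^ ?k)) x"
      using c a by (simp add: wact_eq_iff root_nz root)
    ultimately show "y \<in> (\<lambda>a. wact w (root a) x) ` (Fqr r - {0})"
      by blast
  qed
  hence "card {y\<in>cone. point_of y = point_of x} = card (Fqr r - {0 :: 'k alg_closure})"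
    by (rule bij_betw_same_card[symmetric])
  thus ?thesis
    by (simp add: card_Fqr_units r_pos)
qed

lemma twists_eq: "twists w f r = twist_of ` cone"
  by (auto simp: twists_def orbits_def)

lemma twist_fibre: "x \<in> cone \<Longrightarrow> {y\<in>cone. twist_of y = twist_of x} = twist_of x"
  using twist_of_subset_cone by (auto simp: rat.orbit_eq_iff)

lemma coarse_of_twist_of: "coarse_of w (twist_of x) = point_of x"
proof -
  have "point_of y = point_of x" if "y \<in> twist_of x" for y
    using that by (auto simp: geom.orbit_eq_iff mem_twist_of mem_point_of)
  moreover have "x \<in> twist_of x"
    by (simp add: rat.orbit_refl)
  ultimately show ?thesis
    unfolding coarse_of_def by blast
qed

lemma mass_twist_of: "mass w r (twist_of x) = real (card (twist_of x)) / real (CARD('k) ^ r - 1)"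
proof -
  have "real (card (twist_of x)) * real (g_point w r (point_of x)) = real (CARD('k) ^ r - 1)"
    by (metis card_twist_of of_nat_mult)
  thus ?thesis
    using field_size_gt_1 g_point_pos[of "point_of x"]
    by (simp add: mass_def twist_aut_orbit card_stabilizer divide_simps del: of_nat_diff)
qed

text \<open>
  The mass measure on twists lies over the counting measure on coarse points. Both sides are
  rewritten as the same sum over the vectors of the cone, each weighted by \<open>1 / (q ^ r - 1)\<close>:
  a twist is the fibre of its own vectors, and a coarse point has \<open>q ^ r - 1\<close> of them.
\<close>

lemma sum_mass_coarse:
  "(\<Sum>\<xi>\<in>twists w f r. mass w r \<xi> * h (coarse_of w \<xi>)) = (\<Sum>P\<in>coarse_points w f r. h P)"
proof -
  have q: "real (CARD('k) ^ r - 1) > 0"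
    unfolding of_nat_0_less_iff using field_size_gt_1 by simp
  have "(\<Sum>\<xi>\<in>twists w f r. mass w r \<xi> * h (coarse_of w \<xi>)) =
          (\<Sum>\<xi>\<in>twist_of ` cone. h (coarse_of w \<xi>) / real (CARD('k) ^ r - 1) * real (card {y\<in>cone. twist_of y = \<xi>}))"
    unfolding twists_eq by (intro sum.cong refl) (auto simp: mass_twist_of twist_fibre simp del: of_nat_diff)
  also have "\<dots> = (\<Sum>x\<in>cone. h (point_of x) / real (CARD('k) ^ r - 1))"
    by (subst sum_over_fibres) (simp_all add: finite_cone coarse_of_twist_of)
  also have "\<dots> = (\<Sum>P\<in>point_of ` cone. h P / real (CARD('k) ^ r - 1) * real (card {y\<in>cone. point_of y = P}))"
    by (rule sum_over_fibres[OF finite_cone, symmetric])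
  also have "\<dots> = (\<Sum>P\<in>coarse_points w f r. h P)"
    unfolding coarse_points_eq using q
    by (intro sum.cong refl) (auto simp: card_point_fibre simp del: of_nat_diff)
  finally show ?thesis .
qed

lemma total_mass: "(\<Sum>\<xi>\<in>twists w f r. mass w r \<xi>) = real (card (coarse_points w f r))"
  using sum_mass_coarse[of "\<lambda>_. 1"] by simp

lemma card_cone: "card cone = card (coarse_points w f r) * (CARD('k) ^ r - 1)"
proof -
  have "real (card cone) = (\<Sum>P\<in>point_of ` cone. 1 * real (card {y\<in>cone. point_of y = P}))"
    by (subst sum_over_fibres) (simp_all add: finite_cone)
  also have "\<dots> = (\<Sum>P\<in>coarse_points w f r. real (CARD('k) ^ r - 1))"
    unfolding coarse_points_eq by (intro sum.cong refl) (auto simp: card_point_fibre simp del: of_nat_diff)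
  finally show ?thesis
    by (simp flip: of_nat_mult del: of_nat_diff)
qed

lemma mass_prob_twist_of:
  "mass_prob w f r (twist_of x) =
     1 / (real (card (coarse_points w f r)) * real (g_point w r (point_of x)))"
  unfolding mass_prob_def total_mass by (simp add: mass_def twist_aut_orbit card_stabilizer)

lemma prob_height_vec_eq:
  "prob_height_vec w f r x =
     ln (real (card (coarse_points w f r)) * real (g_point w r (point_of x)))"
proof -
  let ?g = "g_point w r (point_of x)" and ?N = "card (coarse_points w f r)"
  have "card cone = ?N * (card (twist_of x) * ?g)"
    by (simp add: card_cone card_twist_of)
  moreover have "card (twist_of x) > 0"
    using card_twist_of[of x] field_size_gt_1 by (intro Nat.gr0I) auto
  ultimately have "real (card (twist_of x)) / real (card cone) = inverse (real ?N * real ?g)"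
    by (simp add: field_simps)
  thus ?thesis
    by (simp add: prob_height_vec_def ln_inverse del: inverse_mult_distrib)
qed

text \<open>
  The height depends on the coarse point only, since all vectors in that point have the same
  support and hence orbits of the same size.
\<close>

lemma prob_height_eq:
  assumes "P \<in> coarse_points w f r"
  shows "prob_height w f r P = ln (real (card (coarse_points w f r)) * real (g_point w r P))"
proof -
  obtain x where x: "x \<in> cone" "P = point_of x"
    using assms by (auto simp: coarse_points_eq)
  define y where "y = (SOME y. y \<in> P \<and> y \<in> cone)"
  have "\<exists>y. y \<in> P \<and> y \<in> cone"
    using x geom.orbit_refl[of x w] by auto
  hence "y \<in> P \<and> y \<in> cone"
    unfolding y_def by (rule someI_ex)
  hence "point_of y = P"
    by (simp add: x(2) geom.orbit_eq_iff)
  thus ?thesis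
    by (simp add: prob_height_def prob_height_vec_eq flip: y_def)
qed

text \<open>
  The surprisal of a twist is the height of the coarse point below it, term by term.
\<close>

lemma entropy_eq_expected_height:
  "groupoid_entropy w f r =
     (\<Sum>\<xi>\<in>twists w f r. mass_prob w f r \<xi> * prob_height w f r (coarse_of w \<xi>))"
proof -
  have "- ln (mass_prob w f r \<xi>) = prob_height w f r (coarse_of w \<xi>)" if "\<xi> \<in> twists w f r" for \<xi>
  proof -
    obtain x where x: "x \<in> cone" "\<xi> = twist_of x"
      using \<open>\<xi> \<in> twists w f r\<close> by (auto simp: twists_eq)
    have "point_of x \<in> coarse_points w f r"
      using x by (simp add: coarse_points_eq)
    thus ?thesis
      by (simp add: x(2) coarse_of_twist_of prob_height_eq mass_prob_twist_of ln_inverse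
               del: inverse_mult_distrib flip: inverse_eq_divide)
  qed
  hence "- (mass_prob w f r \<xi> * ln (mass_prob w f r \<xi>)) =
           mass_prob w f r \<xi> * prob_height w f r (coarse_of w \<xi>)" if "\<xi> \<in> twists w f r" for \<xi>
    using that by (metis mult_minus_right)
  thus ?thesis
    by (simp add: groupoid_entropy_def flip: sum_negf)
qed

lemma entropy_eq_mean_height:
  "groupoid_entropy w f r =
     1 / real (card (coarse_points w f r)) * (\<Sum>P\<in>coarse_points w f r. prob_height w f r P)"
  unfolding entropy_eq_expected_height
  by (simp add: mass_prob_def total_mass sum_mass_coarse flip: sum_divide_distrib)

lemma entropy_eq_mean_ln_g:
  assumes "coarse_points w f r \<noteq> {}"
  shows "groupoid_entropy w f r =
     ln (real (card (coarse_points w f r)))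
     + 1 / real (card (coarse_points w f r)) * (\<Sum>P\<in>coarse_points w f r. ln (real (g_point w r P)))"
proof -
  have N: "card (coarse_points w f r) > 0"
    using assms finite_coarse_points by (simp add: card_gt_0_iff)
  have "(\<Sum>P\<in>coarse_points w f r. prob_height w f r P) =
          (\<Sum>P\<in>coarse_points w f r. ln (real (card (coarse_points w f r))) + ln (real (g_point w r P)))"
    using N g_point_pos by (intro sum.cong refl) (simp add: prob_height_eq ln_mult)
  thus ?thesis
    using N by (simp add: entropy_eq_mean_height sum.distrib add_divide_distrib)
qed

end


section \<open>Removing the common factor of the weights\<close>

lemma support_gcd_scale: "support_gcd (\<lambda>i. d * w i) S = d * support_gcd w S"
proof -
  have "(\<lambda>i. d * w i) ` S = (*) d ` (w ` S)"
    by auto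
  thus ?thesis
    by (simp only: support_gcd_def Gcd_mult) simp
qed

lemma weighted_homogeneous_scale:
  assumes "weighted_homogeneous (\<lambda>i. d * w i) D f" "d > 0"
  shows "weighted_homogeneous w (D div d) f"
  using assms by (auto simp: weighted_homogeneous_def mult.assoc simp flip: sum_distrib_left)

text \<open>
  Scaling by \<open>c\<close> with the weights \<open>d * w\<close> is scaling by \<open>c ^ d\<close> with the weights \<open>w\<close>, and every
  scalar is a \<open>d\<close>-th power over an algebraically closed field.
\<close>

lemma orbit_scale:
  assumes "d > 0"
  shows "orbit (Gm UNIV) (wact (\<lambda>i. d * w i)) x = orbit (Gm UNIV) (wact w) (x :: 'n \<Rightarrow> 'a::alg_closed_field)"
proof -
  have "wact (\<lambda>i. d * w i) c = wact w (c ^ d)" for c :: 'a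
    by (simp add: wact_def power_mult fun_eq_iff)
  moreover have "\<exists>b. b \<noteq> 0 \<and> b ^ d = c" if "c \<noteq> 0" for c :: 'a
    using nth_root_exists[OF assms, of c] that assms by (auto simp: power_0_left)
  ultimately show ?thesis
    by (auto simp: orbit_def Gm_def) 
qed

lemma coarse_points_scale:
  "d > 0 \<Longrightarrow> coarse_points (\<lambda>i. d * w i) f r = coarse_points w f r"
  by (simp add: coarse_points_def geometric_points_def orbits_def orbit_scale)

lemma gcd_mult_dvd:
  fixes d k m :: nat
  shows "gcd (d * k) m dvd gcd d m * gcd k m"
proof -
  have "gcd (d * k) m dvd gcd (k * d) (k * m)"
    by (metis dvd_mult gcd_dvd1 gcd_dvd2 gcd_greatest mult.commute)
  also have "gcd (k * d) (k * m) = gcd d m * k"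
    by (simp add: gcd_mult_distrib_nat mult.commute)
  finally have "gcd (d * k) m dvd gcd (gcd d m * k) (gcd d m * m)"
    by simp
  thus ?thesis
    by (simp add: gcd_mult_distrib_nat)
qed

lemma gcd_mult_coprime:
  fixes d k m :: nat
  assumes "coprime d k"
  shows "gcd (d * k) m = gcd d m * gcd k m"
proof (rule dvd_antisym[OF gcd_mult_dvd])
  have "coprime (gcd d m) (gcd k m)"
    using assms by (meson coprime_divisors gcd_dvd1)
  thus "gcd d m * gcd k m dvd gcd (d * k) m"
    by (intro gcd_greatest mult_dvd_mono divides_mult) auto
qed

theorem proposition5p13:
  fixes w w' :: "'n::finite \<Rightarrow> nat"
    and f :: "('n, 'k::{field,finite}) mpoly"
    and D d r :: nat
  assumes "\<And>i. w i > 0"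
    and "weighted_homogeneous w D f"
    and "r \<ge> 1"
    and "coarse_points w f r \<noteq> {}"
    and "d = Gcd (range w)"
    and "w' = (\<lambda>i. w i div d)"
  shows
    "groupoid_entropy w f r =
       ln (real (card (coarse_points w f r)))
       + 1 / real (card (coarse_points w f r))
           * (\<Sum>P\<in>coarse_points w f r. ln (real (g_point w r P)))
     \<and> groupoid_entropy w f r =
         (\<Sum>\<xi>\<in>twists w f r. mass_prob w f r \<xi> * prob_height w f r (coarse_of w \<xi>))
     \<and> groupoid_entropy w f r =
         1 / real (card (coarse_points w f r))
           * (\<Sum>P\<in>coarse_points w f r. prob_height w f r P)
     \<and> 0 \<le> groupoid_entropy w f r - groupoid_entropy w' f r
     \<and> groupoid_entropy w f r - groupoid_entropy w' f r
         \<le> ln (real (gcd d (CARD('k) ^ r - 1)))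
     \<and> ((\<forall>P\<in>coarse_points w f r. coprime d (support_gcd w (support_of P) div d))
         \<longrightarrow> groupoid_entropy w f r - groupoid_entropy w' f r
               = ln (real (gcd d (CARD('k) ^ r - 1))))"
proof -
  interpret X: weighted_hypersurface w f D r
    using assms(1-3) by unfold_locales auto
  have d: "d > 0"
    using assms(1) by (auto simp: assms(5) image_subset_iff intro!: Nat.gr0I)
  have w_eq: "w = (\<lambda>i. d * w' i)"
    by (auto simp: assms(5,6) fun_eq_iff)
  have "weighted_homogeneous w' (D div d) f"
    using assms(2) d unfolding w_eq by (rule weighted_homogeneous_scale)
  moreover have "w' i > 0" for i
    using assms(1)[of i] by (simp add: w_eq)
  ultimately interpret X': weighted_hypersurface w' f "D div d" r
    using assms(3) by unfold_locales auto
  let ?X = "coarse_points w f r" and ?m = "CARD('k) ^ r - 1"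
  let ?N = "real (card ?X)"
  have X'_eq: "coarse_points w' f r = ?X"
    using d by (simp add: w_eq coarse_points_scale)
  have N: "?N > 0"
    using assms(4) X.finite_coarse_points by (simp add: card_gt_0_iff)
  have m: "?m > 0"
    using X.field_size_gt_1 by simp
  define \<delta> where "\<delta> P = ln (real (g_point w r P)) - ln (real (g_point w' r P))" for P :: "('n \<Rightarrow> 'k alg_closure) set"
  have diff: "groupoid_entropy w f r - groupoid_entropy w' f r = 1 / ?N * (\<Sum>P\<in>?X. \<delta> P)"
    using X.entropy_eq_mean_ln_g X'.entropy_eq_mean_ln_g assms(4)
    by (simp add: X'_eq \<delta>_def sum_subtractf diff_divide_distrib)
  have g: "g_point w r P = gcd (d * support_gcd w' (support_of P)) ?m"
       "g_point w' r P = gcd (support_gcd w' (support_of P)) ?m" for P :: "('n \<Rightarrow> 'k alg_closure) set"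
    by (simp_all add: g_point_def w_eq support_gcd_scale)
  have \<delta>_nonneg: "0 \<le> \<delta> P" for P
  proof -
    have "g_point w' r P dvd g_point w r P"
      unfolding g by (intro gcd_mono) auto
    hence "g_point w' r P \<le> g_point w r P"
      using X.g_point_pos dvd_imp_le by blast
    thus ?thesis
      using X'.g_point_pos[of P] by (simp add: \<delta>_def)
  qed
  have \<delta>_le: "\<delta> P \<le> ln (real (gcd d ?m))" for P
  proof -
    have "g_point w r P \<le> gcd d ?m * g_point w' r P"
      unfolding g using m by (intro dvd_imp_le gcd_mult_dvd) auto
    hence "real (g_point w r P) \<le> real (gcd d ?m) * real (g_point w' r P)"
      by (metis of_nat_le_iff of_nat_mult)
    hence "ln (real (g_point w r P)) \<le> ln (real (gcd d ?m) * real (g_point w' r P))"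
      using X.g_point_pos[of P] by (intro ln_mono) auto
    also have "\<dots> = ln (real (gcd d ?m)) + ln (real (g_point w' r P))"
      using X'.g_point_pos[of P] d by (intro ln_mult_pos) auto
    finally show ?thesis
      by (simp add: \<delta>_def)
  qed
  have \<delta>_eq: "\<delta> P = ln (real (gcd d ?m))" if "coprime d (support_gcd w (support_of P) div d)" for P
  proof -
    have "coprime d (support_gcd w' (support_of P))"
      using that d by (simp add: w_eq support_gcd_scale)
    hence "g_point w r P = gcd d ?m * g_point w' r P"
      unfolding g by (rule gcd_mult_coprime)
    hence "real (g_point w r P) = real (gcd d ?m) * real (g_point w' r P)"
      by (metis of_nat_mult)
    thus ?thesis
      using X'.g_point_pos[of P] d by (simp add: \<delta>_def ln_mult_pos)
  qed
  let ?diff = "groupoid_entropy w f r - groupoid_entropy w' f r"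
  have "0 \<le> ?diff"
    unfolding diff by (intro mult_nonneg_nonneg sum_nonneg \<delta>_nonneg) auto
  moreover have "?diff \<le> ln (real (gcd d ?m))"
  proof -
    have "(\<Sum>P\<in>?X. \<delta> P) \<le> ?N * ln (real (gcd d ?m))"
      by (intro sum_bounded_above \<delta>_le)
    thus ?thesis
      unfolding diff using N by (simp add: pos_divide_le_eq mult.commute)
  qed
  moreover have "?diff = ln (real (gcd d ?m))"
    if "\<forall>P\<in>?X. coprime d (support_gcd w (support_of P) div d)"
    unfolding diff using that N by (simp add: \<delta>_eq)
  ultimately show ?thesis
    using X.entropy_eq_mean_ln_g[OF assms(4)] X.entropy_eq_expected_height
      X.entropy_eq_mean_height
    by blast
qed

end
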